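(* Let $\gamma$ be an infinite cardinal, let $\nu$ be a regular cardinal, and let $\mathbb Q$ be a ${<}(\nu^{<\gamma})^+$-complete Boolean algebra. Then $\mathbb Q$ is $(\gamma,\nu)$-distributive if and only if for every nonzero $X\in\mathbb Q$, Cut does not have a winning strategy in the game $\mathcal G_\nu(X,\mathbb Q,\gamma)$.
   Context: $\nu^{<\gamma}=\sup\{\nu^\delta\mid\delta<\gamma\text{ is a cardinal}\}$. A Boolean algebra is ${<}\theta$-complete if all of its subsets of size less than $\theta$ have suprema and infima. When a Boolean algebra $\mathbb Q$ is considered as a poset, its elements are the nonzero elements of the algebra, so "lower bound" means nonzero lower bound, and antichains consist of nonzero elements with pairwise meet $0$. The game $\mathcal G_\nu(X,\mathbb Q,\gamma)$ has $\gamma$ many rounds, played by Cut and Choose: in each round, Cut plays a maximal antichain of $\mathbb Q$ below $X$ of size at most $\nu$, and Choose responds by picking one of its elements. Choose wins if the sequence of all of their choices has a lower bound in $\mathbb Q$, and Cut wins otherwise. $\mathbb Q$ is $(\gamma,\nu)$-distributive if for every $X\in\mathbb Q$ and every sequence $\langle W_\alpha\mid\alpha<\gamma\rangle$ of maximal antichains of $\mathbb Q$ below $X$, each of size at most $\nu$, there is a sequence $\langle X_\alpha\mid\alpha<\gamma\rangle$ with $X_\alpha\in W_\alpha$ for each $\alpha<\gamma$ such that $\{X_\alpha\mid\alpha<\gamma\}$ has a lower bound in $\mathbb Q$. *)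

theory Defs
  imports Main "HOL-Library.FuncSet"
begin

unbundle cardinal_syntax

text \<open>Cardinals are represented by cardinal orders, as in the library. Suprema are determined only
  up to order isomorphism.\<close>

definition is_card_sup :: "'k rel set \<Rightarrow> 'k rel \<Rightarrow> bool" where
  "is_card_sup R \<kappa> \<longleftrightarrow>
     Card_order \<kappa> \<and> (\<forall>r\<in>R. r \<le>o \<kappa>) \<and>
     (\<forall>\<mu> :: 'k rel. Card_order \<mu> \<and> (\<forall>r\<in>R. r \<le>o \<mu>) \<longrightarrow> \<kappa> \<le>o \<mu>)"

text \<open>The cardinal \<open>\<nu>\<^bsup><\<gamma>\<^esup>\<close>. Every cardinal below \<open>\<gamma>\<close> has a representative on the type of \<open>\<gamma>\<close>, so nothing
  is lost by letting \<open>\<delta>\<close> range over that type only. Existence of the supremum, and its minimality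
  with respect to cardinals on arbitrary types, are shown below.\<close>

definition cexp_lt :: "'n rel \<Rightarrow> 'g rel \<Rightarrow> ('g \<Rightarrow> 'n) rel" where
  "cexp_lt \<nu> \<gamma> =
     (SOME \<kappa>. is_card_sup {\<nu> ^c \<delta> | \<delta> :: 'g rel. Card_order \<delta> \<and> \<delta> <o \<gamma>} \<kappa>)"

lemma is_card_sup_cexp_lt:
  fixes \<gamma> :: "'g rel" and \<nu> :: "'n rel"
  shows "is_card_sup {\<nu> ^c \<delta> | \<delta> :: 'g rel. Card_order \<delta> \<and> \<delta> <o \<gamma>} (cexp_lt \<nu> \<gamma>)"
proof -
  let ?R = "{\<nu> ^c \<delta> | \<delta> :: 'g rel. Card_order \<delta> \<and> \<delta> <o \<gamma>}"
  let ?U = "{\<kappa> :: ('g \<Rightarrow> 'n) rel. Card_order \<kappa> \<and> (\<forall>r\<in>?R. r \<le>o \<kappa>)}"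
  have "\<nu> ^c \<delta> \<le>o |UNIV :: ('g \<Rightarrow> 'n) set|" for \<delta> :: "'g rel"
    unfolding cexp_def by (rule card_of_mono1) simp
  hence "|UNIV :: ('g \<Rightarrow> 'n) set| \<in> ?U"
    using card_of_Card_order[of "UNIV :: ('g \<Rightarrow> 'n) set"] by auto
  hence "?U \<noteq> {}" by (metis empty_iff)
  moreover have "\<forall>r\<in>?U. Card_order r" by simp
  ultimately have "\<exists>r\<in>?U. \<forall>r'\<in>?U. r \<le>o r'" by (rule exists_minim_Card_order)
  then obtain \<kappa> where "\<kappa> \<in> ?U" "\<forall>r\<in>?U. \<kappa> \<le>o r" ..
  hence "is_card_sup ?R \<kappa>" unfolding is_card_sup_def by simp
  thus ?thesis unfolding cexp_lt_def by (rule someI)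
qed

lemma cexp_lt_least:
  fixes \<gamma> :: "'g rel" and \<nu> :: "'n rel" and \<mu> :: "'m rel"
  assumes \<mu>: "Card_order \<mu>"
    and ub: "\<And>\<delta> :: 'g rel. Card_order \<delta> \<Longrightarrow> \<delta> <o \<gamma> \<Longrightarrow> \<nu> ^c \<delta> \<le>o \<mu>"
  shows "cexp_lt \<nu> \<gamma> \<le>o \<mu>"
proof (rule ccontr)
  let ?\<kappa> = "cexp_lt \<nu> \<gamma>"
  note sup = is_card_sup_cexp_lt[of \<nu> \<gamma>, unfolded is_card_sup_def]
  have \<kappa>: "Card_order ?\<kappa>" using sup by (rule conjunct1)
  assume neg: "\<not> ?\<kappa> \<le>o \<mu>"
  have "\<mu> \<le>o ?\<kappa>"
    using neg ordLeq_total[OF card_order_on_well_order_on[OF \<kappa>]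
        card_order_on_well_order_on[OF \<mu>]]
    by simp
  hence "|Field \<mu>| \<le>o |Field ?\<kappa>|" by (rule card_of_mono2)
  then obtain f where f: "inj_on f (Field \<mu>)" "f ` Field \<mu> \<subseteq> Field ?\<kappa>"
    unfolding card_of_ordLeq[symmetric] by blast
  have "|Field \<mu>| =o |f ` Field \<mu>|"
    by (rule card_of_ordIsoI[OF inj_on_imp_bij_betw[OF f(1)]])
  hence iso: "\<mu> =o |f ` Field \<mu>|"
    by (rule ordIso_transitive[OF ordIso_symmetric[OF card_of_Field_ordIso[OF \<mu>]]])
  have "\<nu> ^c \<delta> \<le>o |f ` Field \<mu>|" if "Card_order \<delta>" "\<delta> <o \<gamma>" for \<delta> :: "'g rel"
    using ordLeq_ordIso_trans[OF ub[OF that] iso] .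
  hence "?\<kappa> \<le>o |f ` Field \<mu>|" 
    using conjunct2[OF conjunct2[OF sup], rule_format, of "|f ` Field \<mu>|"]
      card_of_Card_order[of "f ` Field \<mu>"] by auto
  hence "?\<kappa> \<le>o \<mu>" by (rule ordLeq_ordIso_trans[OF _ ordIso_symmetric[OF iso]])
  with neg show False ..
qed

definition lt_complete :: "'k rel \<Rightarrow> 'a::boolean_algebra itself \<Rightarrow> bool" where
  "lt_complete \<theta> (_ :: 'a itself) \<longleftrightarrow>
     (\<forall>A :: 'a set. |A| <o \<theta> \<longrightarrow>
        (\<exists>s. (\<forall>a\<in>A. a \<le> s) \<and> (\<forall>u. (\<forall>a\<in>A. a \<le> u) \<longrightarrow> s \<le> u)) \<and>
        (\<exists>i. (\<forall>a\<in>A. i \<le> a) \<and> (\<forall>l. (\<forall>a\<in>A. l \<le> a) \<longrightarrow> l \<le> i)))"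

definition antichain_below :: "'a::boolean_algebra \<Rightarrow> 'a set \<Rightarrow> bool" where
  "antichain_below X W \<longleftrightarrow>
     (\<forall>w\<in>W. w \<noteq> bot \<and> w \<le> X) \<and> (\<forall>v\<in>W. \<forall>w\<in>W. v \<noteq> w \<longrightarrow> inf v w = bot)"

definition max_antichain_below :: "'a::boolean_algebra \<Rightarrow> 'a set \<Rightarrow> bool" where
  "max_antichain_below X W \<longleftrightarrow>
     antichain_below X W \<and> (\<forall>W'. antichain_below X W' \<and> W \<subseteq> W' \<longrightarrow> W' = W)"

definition has_nonzero_lower_bound :: "'a::boolean_algebra set \<Rightarrow> bool" where
  "has_nonzero_lower_bound A \<longleftrightarrow> (\<exists>Z. Z \<noteq> bot \<and> (\<forall>a\<in>A. Z \<le> a))"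

text \<open>Sequences of length \<open>\<gamma>\<close> are functions considered on \<open>Field \<gamma>\<close>, which is well-ordered by
  \<open>\<gamma>\<close> in the order type of the corresponding initial ordinal.\<close>

definition distributive_alg :: "'g rel \<Rightarrow> 'n rel \<Rightarrow> 'a::boolean_algebra itself \<Rightarrow> bool" where
  "distributive_alg \<gamma> \<nu> (_ :: 'a itself) \<longleftrightarrow>
     (\<forall>(X :: 'a) W. X \<noteq> bot \<and>
        (\<forall>\<alpha>\<in>Field \<gamma>. max_antichain_below X (W \<alpha>) \<and> |W \<alpha>| \<le>o \<nu>) \<longrightarrow>
        (\<exists>x. (\<forall>\<alpha>\<in>Field \<gamma>. x \<alpha> \<in> W \<alpha>) \<and> has_nonzero_lower_bound (x ` Field \<gamma>)))"

text \<open>The game: \<open>p \<alpha>\<close> is the pair consisting of Cut's move and of Choose's response in round \<open>\<alpha>\<close>.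
  The position at the start of round \<open>\<alpha>\<close> is the restriction of \<open>p\<close> to the earlier rounds
  \<open>underS \<gamma> \<alpha>\<close>.\<close>

definition cut_move :: "'n rel \<Rightarrow> 'a::boolean_algebra \<Rightarrow> 'a set \<Rightarrow> bool" where
  "cut_move \<nu> X W \<longleftrightarrow> max_antichain_below X W \<and> |W| \<le>o \<nu>"

definition legal_play ::
    "'n rel \<Rightarrow> 'a::boolean_algebra \<Rightarrow> 'g set \<Rightarrow> ('g \<Rightarrow> 'a set \<times> 'a) \<Rightarrow> bool" where
  "legal_play \<nu> X I p \<longleftrightarrow> (\<forall>\<beta>\<in>I. cut_move \<nu> X (fst (p \<beta>)) \<and> snd (p \<beta>) \<in> fst (p \<beta>))"

definition choose_wins :: "'g rel \<Rightarrow> ('g \<Rightarrow> 'a::boolean_algebra set \<times> 'a) \<Rightarrow> bool" where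
  "choose_wins \<gamma> p \<longleftrightarrow> has_nonzero_lower_bound ((\<lambda>\<alpha>. snd (p \<alpha>)) ` Field \<gamma>)"

text \<open>A strategy must give a legal move at every legal position; otherwise Cut could win
  vacuously by playing something to which Choose cannot respond.\<close>

definition cut_strategy ::
    "'n rel \<Rightarrow> 'a::boolean_algebra \<Rightarrow> 'g rel \<Rightarrow> ('g \<Rightarrow> ('g \<Rightarrow> 'a set \<times> 'a) \<Rightarrow> 'a set) \<Rightarrow> bool" where
  "cut_strategy \<nu> X \<gamma> \<sigma> \<longleftrightarrow>
     (\<forall>\<alpha>\<in>Field \<gamma>. \<forall>p. legal_play \<nu> X (underS \<gamma> \<alpha>) p \<longrightarrow>
        cut_move \<nu> X (\<sigma> \<alpha> (restrict p (underS \<gamma> \<alpha>))))"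

definition follows ::
    "'g rel \<Rightarrow> ('g \<Rightarrow> ('g \<Rightarrow> 'a set \<times> 'a) \<Rightarrow> 'a set) \<Rightarrow> ('g \<Rightarrow> 'a set \<times> 'a) \<Rightarrow> bool" where
  "follows \<gamma> \<sigma> p \<longleftrightarrow> (\<forall>\<alpha>\<in>Field \<gamma>. fst (p \<alpha>) = \<sigma> \<alpha> (restrict p (underS \<gamma> \<alpha>)))"

definition cut_winning_strategy ::
    "'n rel \<Rightarrow> 'a::boolean_algebra \<Rightarrow> 'g rel \<Rightarrow> ('g \<Rightarrow> ('g \<Rightarrow> 'a set \<times> 'a) \<Rightarrow> 'a set) \<Rightarrow> bool" where
  "cut_winning_strategy \<nu> X \<gamma> \<sigma> \<longleftrightarrow>
     cut_strategy \<nu> X \<gamma> \<sigma> \<and>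
     (\<forall>p. legal_play \<nu> X (Field \<gamma>) p \<and> follows \<gamma> \<sigma> p \<longrightarrow> \<not> choose_wins \<gamma> p)"

end

theory Submission
  imports Defs
begin

text \<open>If \<open>\<gamma>\<close> many antichains below \<open>X\<close> violate distributivity, Cut wins from \<open>X\<close> by playing them one
  after the other without looking at the responses (\<open>no_winning_strategy_distributive\<close>).

  Conversely, let Cut follow a strategy. Numbering each of Cut's antichains by \<open>Field \<nu>\<close> turns
  Choose's responses into a function \<open>f\<close> from \<open>Field \<gamma>\<close> to \<open>Field \<nu>\<close>, and Cut's move in round \<open>\<alpha>\<close> into a
  partition \<open>m \<alpha> f\<close> that depends on the restriction of \<open>f\<close> to earlier rounds; choosing \<open>i\<close> means taking
  the piece \<open>m \<alpha> f i\<close>. Distributivity cannot be applied to these partitions, since there is a whole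
  tree of them, possibly with more than \<open>\<nu>\<close> nodes on a level. In the language of forcing, however, a
  generic filter singles out one branch of the tree, and the Boolean value
  \<open>U \<alpha> i\<close> of the event that this branch takes the value \<open>i\<close> at \<open>\<alpha>\<close> is the join of the meets of the
  branches of length \<open>\<alpha> + 1\<close> that end in \<open>i\<close>. There are at most \<open>\<nu>\<^bsup><\<gamma>\<^esup>\<close> such branches,
  which is why the completeness hypothesis provides the join (\<open>branch_bounds_lub\<close>).

  For each \<open>\<alpha>\<close> the values \<open>U \<alpha> i\<close> partition \<open>X\<close> into at most \<open>\<nu>\<close> pieces. They are disjoint because
  different branches are. That they exhaust \<open>X\<close> is shown by induction on \<open>\<alpha>\<close>: below any \<open>Y\<close>, apply
  distributivity to the earlier \<open>U \<beta>\<close>. This yields a nonzero \<open>Z\<close> that decides the branch below \<open>\<alpha>\<close>, and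
  hence lies below all of its pieces (\<open>decided_branch\<close>); then \<open>Z\<close> meets a piece of the next partition.
  One last application of distributivity, to all the \<open>U \<alpha>\<close>, gives a nonzero element that decides a
  branch of full length (\<open>distributive_adaptive\<close>). It is a lower bound of the choices in a
  play in which Cut follows the strategy, so the strategy is not winning.\<close>

section \<open>Indexed partitions\<close>

text \<open>Pieces may be \<open>bot\<close>, so that every maximal antichain of size at most \<open>\<nu>\<close> can be indexed by the
  same set \<open>Field \<nu>\<close>. Pieces may stick out of \<open>X\<close>, so that a partition of \<open>X\<close> is also one
  of every smaller element.\<close>

definition indexed_partition :: "'i set \<Rightarrow> 'a::boolean_algebra \<Rightarrow> ('i \<Rightarrow> 'a) \<Rightarrow> bool" where
  "indexed_partition I X P \<longleftrightarrow>
     (\<forall>i\<in>I. \<forall>j\<in>I. i \<noteq> j \<longrightarrow> inf (P i) (P j) = bot) \<and>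
     (\<forall>Y. Y \<noteq> bot \<and> Y \<le> X \<longrightarrow> (\<exists>i\<in>I. inf Y (P i) \<noteq> bot))"

lemma max_antichain_below_iff:
  fixes X :: "'a::boolean_algebra"
  shows "max_antichain_below X W \<longleftrightarrow>
    antichain_below X W \<and> (\<forall>Y. Y \<noteq> bot \<and> Y \<le> X \<longrightarrow> (\<exists>w\<in>W. inf Y w \<noteq> bot))"
proof (intro iffI conjI allI impI)
  assume "max_antichain_below X W"
  then show "antichain_below X W" by (simp add: max_antichain_below_def)
next
  fix Y assume W: "max_antichain_below X W" and Y: "Y \<noteq> bot \<and> Y \<le> X"
  show "\<exists>w\<in>W. inf Y w \<noteq> bot"
  proof (rule ccontr)
    assume neg: "\<not> (\<exists>w\<in>W. inf Y w \<noteq> bot)"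
    then have "antichain_below X (insert Y W)"
      using W Y unfolding max_antichain_below_def antichain_below_def
      by (auto simp: inf.commute)
    then have "insert Y W = W"
      using W unfolding max_antichain_below_def by blast
    then show False using neg Y by (metis inf.idem insertI1)
  qed
next
  assume W: "antichain_below X W \<and> (\<forall>Y. Y \<noteq> bot \<and> Y \<le> X \<longrightarrow> (\<exists>w\<in>W. inf Y w \<noteq> bot))"
  have "W' = W" if W': "antichain_below X W'" "W \<subseteq> W'" for W'
  proof
    show "W' \<subseteq> W"
    proof
      fix y assume y: "y \<in> W'"
      then have "y \<noteq> bot \<and> y \<le> X" using W'(1) by (simp add: antichain_below_def)
      then obtain w where w: "w \<in> W" "inf y w \<noteq> bot" using W by metis
      then have "w \<in> W'" using W'(2) by auto
      then have "y = w" using W'(1) y w(2) unfolding antichain_below_def by metis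
      then show "y \<in> W" using w(1) by simp
    qed
  qed (rule W'(2))
  then show "max_antichain_below X W"
    using W by (simp add: max_antichain_below_def)
qed

lemma cut_move_singleton:
  fixes X :: "'a::boolean_algebra" and \<nu> :: "'n rel"
  assumes "Cinfinite \<nu>" "X \<noteq> bot"
  shows "cut_move \<nu> X {X}"
proof -
  have "max_antichain_below X {X}"
    unfolding max_antichain_below_iff using assms(2)
    by (auto simp: antichain_below_def inf_absorb1)
  moreover have "|{X}| \<le>o \<nu>"
    using assms(1) by (intro ordLess_imp_ordLeq Cfinite_ordLess_Cinfinite)
      (simp_all add: cfinite_def Field_card_of card_of_card_order_on)
  ultimately show ?thesis by (simp add: cut_move_def)
qed

lemma cut_move_indexed:
  fixes X :: "'a::boolean_algebra" and \<nu> :: "'n rel"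
  assumes \<nu>: "Card_order \<nu>" and W: "cut_move \<nu> X W"
  shows "\<exists>P. indexed_partition (Field \<nu>) X P \<and> (\<forall>i. P i \<noteq> bot \<longrightarrow> P i \<in> W)"
proof -
  have "|W| \<le>o |Field \<nu>|"
    using W ordLeq_ordIso_trans[OF _ ordIso_symmetric[OF card_of_Field_ordIso[OF \<nu>]]]
    unfolding cut_move_def by blast
  then obtain e where e: "inj_on e W" "e ` W \<subseteq> Field \<nu>"
    unfolding card_of_ordLeq[symmetric] by blast
  define P where "P i = (if i \<in> e ` W then inv_into W e i else bot)" for i
  have Pe: "P (e w) = w" if "w \<in> W" for w
    using that e(1) unfolding P_def by (simp add: inv_into_f_f)
  have PW: "P i \<noteq> bot \<Longrightarrow> P i \<in> W" for i
    unfolding P_def by (metis inv_into_into)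
  have eP: "e (P i) = i" if "P i \<noteq> bot" for i
  proof -
    have "i \<in> e ` W" using that by (rule contrapos_np) (simp add: P_def)
    then show ?thesis by (simp add: P_def f_inv_into_f)
  qed
  have "indexed_partition (Field \<nu>) X P"
    unfolding indexed_partition_def
  proof (intro conjI ballI allI impI)
    fix i j :: 'n assume ij: "i \<noteq> j"
    show "inf (P i) (P j) = bot"
    proof (cases "P i = bot \<or> P j = bot")
      case False
      then have "P i \<noteq> P j" "P i \<in> W" "P j \<in> W" using ij eP PW by metis+
      then show ?thesis
        using W unfolding cut_move_def max_antichain_below_iff antichain_below_def by blast
    qed auto
  next
    fix Y assume "Y \<noteq> bot \<and> Y \<le> X"
    then obtain w where "w \<in> W" "inf Y w \<noteq> bot"
      using W unfolding cut_move_def max_antichain_below_iff by blast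
    then show "\<exists>i\<in>Field \<nu>. inf Y (P i) \<noteq> bot"
      using Pe e(2) by (metis image_subset_iff)
  qed
  then show ?thesis using PW by blast
qed

text \<open>The form in which distributivity is used: the result is a choice of indices, which can be fed
  back into partitions that depend on earlier indices.\<close>

lemma distributive_alg_indexed:
  fixes Y :: "'a::boolean_algebra" and \<gamma> :: "'g rel" and \<nu> :: "'n rel"
  assumes dist: "distributive_alg \<gamma> \<nu> TYPE('a)" and \<nu>: "Card_order \<nu>"
    and Y: "Y \<noteq> bot"
    and P: "\<forall>\<alpha>\<in>Field \<gamma>. indexed_partition (Field \<nu>) Y (P \<alpha>)"
    and ne: "Field \<gamma> \<noteq> {}"
  shows "\<exists>f Z. Z \<noteq> bot \<and> Z \<le> Y \<and> (\<forall>\<alpha>\<in>Field \<gamma>. f \<alpha> \<in> Field \<nu> \<and> Z \<le> P \<alpha> (f \<alpha>))"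
proof -
  define W where "W \<alpha> = (\<lambda>i. inf Y (P \<alpha> i)) ` Field \<nu> - {bot}" for \<alpha>
  have "max_antichain_below Y (W \<alpha>) \<and> |W \<alpha>| \<le>o \<nu>" if \<alpha>: "\<alpha> \<in> Field \<gamma>" for \<alpha>
  proof
    have "antichain_below Y (W \<alpha>)"
      unfolding antichain_below_def
    proof (intro conjI ballI impI)
      fix v w assume "v \<in> W \<alpha>" "w \<in> W \<alpha>" "v \<noteq> w"
      then obtain i j where ij: "i \<in> Field \<nu>" "j \<in> Field \<nu>" "i \<noteq> j"
        "v = inf Y (P \<alpha> i)" "w = inf Y (P \<alpha> j)"
        unfolding W_def by blast
      then have "inf (P \<alpha> i) (P \<alpha> j) = bot"
        using bspec[OF P \<alpha>] unfolding indexed_partition_def by blast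
      moreover have "inf v w \<le> inf (P \<alpha> i) (P \<alpha> j)"
        unfolding ij by (simp add: le_infI1 le_infI2)
      ultimately show "inf v w = bot" by (simp add: le_bot)
    qed (auto simp: W_def)
    moreover have "\<exists>w\<in>W \<alpha>. inf Z w \<noteq> bot" if Z: "Z \<noteq> bot" "Z \<le> Y" for Z
    proof -
      obtain i where i: "i \<in> Field \<nu>" "inf Z (P \<alpha> i) \<noteq> bot"
        using bspec[OF P \<alpha>] Z unfolding indexed_partition_def by blast
      have eq: "inf Z (inf Y (P \<alpha> i)) = inf Z (P \<alpha> i)"
        using Z(2) by (simp add: inf_absorb1 inf_assoc[symmetric])
      with i have "inf Y (P \<alpha> i) \<in> W \<alpha>" unfolding W_def by auto
      with i eq show ?thesis by metis
    qed
    ultimately show "max_antichain_below Y (W \<alpha>)"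
      unfolding max_antichain_below_iff by blast
    have "|W \<alpha>| \<le>o |(\<lambda>i. inf Y (P \<alpha> i)) ` Field \<nu>|"
      unfolding W_def by (intro card_of_mono1) blast
    also have "|(\<lambda>i. inf Y (P \<alpha> i)) ` Field \<nu>| \<le>o |Field \<nu>|" by (rule card_of_image)
    also have "|Field \<nu>| =o \<nu>" by (rule card_of_Field_ordIso[OF \<nu>])
    finally show "|W \<alpha>| \<le>o \<nu>" .
  qed
  then obtain x where x: "\<forall>\<alpha>\<in>Field \<gamma>. x \<alpha> \<in> W \<alpha>"
    and "has_nonzero_lower_bound (x ` Field \<gamma>)"
    using dist[unfolded distributive_alg_def, rule_format, of Y W] Y by blast
  then obtain Z where Z: "Z \<noteq> bot" "\<forall>\<alpha>\<in>Field \<gamma>. Z \<le> x \<alpha>"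
    unfolding has_nonzero_lower_bound_def by blast
  have "\<forall>\<alpha>\<in>Field \<gamma>. \<exists>i. i \<in> Field \<nu> \<and> x \<alpha> = inf Y (P \<alpha> i)"
    using x unfolding W_def by blast
  then obtain f where f: "\<forall>\<alpha>\<in>Field \<gamma>. f \<alpha> \<in> Field \<nu> \<and> x \<alpha> = inf Y (P \<alpha> (f \<alpha>))"
    by (rule bchoice[elim_format]) blast
  have below: "Z \<le> inf Y (P \<alpha> (f \<alpha>))" if "\<alpha> \<in> Field \<gamma>" for \<alpha>
    using Z(2) f that by metis
  then have "Z \<le> Y" using ne by auto
  moreover have "\<forall>\<alpha>\<in>Field \<gamma>. f \<alpha> \<in> Field \<nu> \<and> Z \<le> P \<alpha> (f \<alpha>)"
    using below f by simp
  ultimately show ?thesis using Z(1) by (intro exI[of _ f] exI[of _ Z]) simp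
qed

section \<open>Adaptive partitions\<close>

text \<open>The trees of partitions that strategies give rise to: \<open>m \<alpha> f\<close> is the partition at the node
  reached along the branch \<open>f\<close> after all rounds before \<open>\<alpha>\<close>.\<close>

definition adaptive ::
    "'g rel \<Rightarrow> 'n rel \<Rightarrow> 'a::boolean_algebra \<Rightarrow> ('g \<Rightarrow> ('g \<Rightarrow> 'n) \<Rightarrow> 'n \<Rightarrow> 'a) \<Rightarrow> bool" where
  "adaptive \<gamma> \<nu> X m \<longleftrightarrow>
     (\<forall>\<alpha>\<in>Field \<gamma>. \<forall>f. indexed_partition (Field \<nu>) X (m \<alpha> f)) \<and>
     (\<forall>\<alpha>\<in>Field \<gamma>. \<forall>f g. (\<forall>\<beta>\<in>underS \<gamma> \<alpha>. f \<beta> = g \<beta>) \<longrightarrow> m \<alpha> f = m \<alpha> g)"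

text \<open>The least upper bound of this set is the Boolean value of the event that the generic branch
  takes the value \<open>i\<close> at \<open>\<alpha>\<close>. Using all lower bounds of the branches, instead of their meets,
  describes this value without infinite meets.\<close>

definition branch_bounds ::
    "'g rel \<Rightarrow> 'n rel \<Rightarrow> ('g \<Rightarrow> ('g \<Rightarrow> 'n) \<Rightarrow> 'n \<Rightarrow> 'a::boolean_algebra) \<Rightarrow> 'g \<Rightarrow> 'n \<Rightarrow> 'a set" where
  "branch_bounds \<gamma> \<nu> m \<alpha> i =
     {Z. \<exists>f. f \<alpha> = i \<and> (\<forall>\<beta>\<in>under \<gamma> \<alpha>. f \<beta> \<in> Field \<nu> \<and> Z \<le> m \<beta> f (f \<beta>))}"

lemma lt_complete_lub:
  fixes A :: "'a::boolean_algebra set"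
  assumes "lt_complete \<theta> TYPE('a)" "|A| <o \<theta>"
  shows "\<exists>s. (\<forall>a\<in>A. a \<le> s) \<and> (\<forall>u. (\<forall>a\<in>A. a \<le> u) \<longrightarrow> s \<le> u)"
  using mp[OF spec[OF assms(1)[unfolded lt_complete_def]] assms(2)] by (rule conjunct1)

lemma lt_complete_glb:
  fixes A :: "'a::boolean_algebra set"
  assumes "lt_complete \<theta> TYPE('a)" "|A| <o \<theta>"
  shows "\<exists>i. (\<forall>a\<in>A. i \<le> a) \<and> (\<forall>l. (\<forall>a\<in>A. l \<le> a) \<longrightarrow> l \<le> i)"
  using mp[OF spec[OF assms(1)[unfolded lt_complete_def]] assms(2)] by (rule conjunct2)

text \<open>The half of the infinite distributive law that holds in every Boolean algebra in which the
  join in question exists.\<close>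

lemma inf_lub_le:
  fixes Z :: "'a::boolean_algebra"
  assumes "\<forall>u. (\<forall>a\<in>A. a \<le> u) \<longrightarrow> s \<le> u" and "\<And>a. a \<in> A \<Longrightarrow> inf Z a \<le> u"
  shows "inf Z s \<le> u"
  using assms by (metis inf.commute shunt1)

lemma Well_order_transD:
  assumes "Well_order \<gamma>" "(x, y) \<in> \<gamma>" "(y, z) \<in> \<gamma>" shows "(x, z) \<in> \<gamma>"
  using assms(1) transD[OF _ assms(2,3)] by (simp add: order_on_defs)

lemma Well_order_antisymD:
  assumes "Well_order \<gamma>" "(x, y) \<in> \<gamma>" "(y, x) \<in> \<gamma>" shows "x = y"
  using assms(1) antisymD[OF _ assms(2,3)] by (simp add: order_on_defs)

lemma underS_under_trans:
  assumes wo: "Well_order \<gamma>" and "\<beta> \<in> underS \<gamma> \<alpha>" "\<eta> \<in> under \<gamma> \<beta>"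
  shows "\<eta> \<in> underS \<gamma> \<alpha>"
proof -
  have *: "(\<eta>, \<beta>) \<in> \<gamma>" "(\<beta>, \<alpha>) \<in> \<gamma>" "\<beta> \<noteq> \<alpha>"
    using assms by (auto simp: under_def underS_def)
  have "\<eta> \<noteq> \<alpha>" using Well_order_antisymD[OF wo, of \<beta> \<alpha>] * by metis
  with Well_order_transD[OF wo *(1,2)] show ?thesis by (simp add: underS_def)
qed

lemma under_underS_trans:
  assumes wo: "Well_order \<gamma>" and "\<beta> \<in> under \<gamma> \<alpha>" "\<eta> \<in> underS \<gamma> \<beta>"
  shows "\<eta> \<in> underS \<gamma> \<alpha>"
proof -
  have *: "(\<eta>, \<beta>) \<in> \<gamma>" "(\<beta>, \<alpha>) \<in> \<gamma>" "\<eta> \<noteq> \<beta>"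
    using assms by (auto simp: under_def underS_def)
  have "\<eta> \<noteq> \<alpha>" using Well_order_antisymD[OF wo, of \<beta> \<alpha>] * by metis
  with Well_order_transD[OF wo *(1,2)] show ?thesis by (simp add: underS_def)
qed

lemma under_self:
  assumes "Well_order \<gamma>" "\<alpha> \<in> Field \<gamma>" shows "\<alpha> \<in> under \<gamma> \<alpha>"
  using assms refl_onD[of "Field \<gamma>" \<gamma> \<alpha>] by (simp add: under_def order_on_defs)

lemma wf_strict:
  assumes "Well_order \<gamma>" shows "wf (\<gamma> - Id)"
  using assms by (simp add: well_order_on_def)

text \<open>At the first place where two branches differ they have passed through the same node, so they
  pick disjoint pieces of one partition.\<close>

lemma adaptive_first_difference:
  fixes X :: "'a::boolean_algebra" and \<gamma> :: "'g rel"
  assumes wo: "Well_order \<gamma>" and ad: "adaptive \<gamma> \<nu> X m" and \<alpha>: "\<alpha> \<in> Field \<gamma>"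
    and f: "\<forall>\<beta>\<in>under \<gamma> \<alpha>. f \<beta> \<in> Field \<nu>" and g: "\<forall>\<beta>\<in>under \<gamma> \<alpha>. g \<beta> \<in> Field \<nu>"
    and diff: "\<beta> \<in> under \<gamma> \<alpha>" "f \<beta> \<noteq> g \<beta>"
  obtains \<eta> where "\<eta> \<in> under \<gamma> \<alpha>" "f \<eta> \<noteq> g \<eta>" "inf (m \<eta> f (f \<eta>)) (m \<eta> g (g \<eta>)) = bot"
proof -
  have "\<beta> \<in> {\<xi> \<in> under \<gamma> \<alpha>. f \<xi> \<noteq> g \<xi>}" using diff by simp
  then obtain \<eta> where "\<eta> \<in> {\<xi> \<in> under \<gamma> \<alpha>. f \<xi> \<noteq> g \<xi>}"
    and least: "\<And>\<xi>. (\<xi>, \<eta>) \<in> \<gamma> - Id \<Longrightarrow> \<xi> \<notin> {\<xi> \<in> under \<gamma> \<alpha>. f \<xi> \<noteq> g \<xi>}"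
    by (rule wfE_min[OF wf_strict[OF wo]]) blast
  then have \<eta>: "\<eta> \<in> under \<gamma> \<alpha>" "f \<eta> \<noteq> g \<eta>" by simp_all
  have "f \<xi> = g \<xi>" if \<xi>: "\<xi> \<in> underS \<gamma> \<eta>" for \<xi>
  proof -
    have "\<xi> \<in> under \<gamma> \<alpha>"
      using under_underS_trans[OF wo \<eta>(1) \<xi>] underS_subset_under[of \<gamma> \<alpha>] by blast
    moreover have "(\<xi>, \<eta>) \<in> \<gamma> - Id" using \<xi> by (simp add: underS_def)
    ultimately show ?thesis using least[of \<xi>] by simp
  qed
  then have agree: "\<forall>\<xi>\<in>underS \<gamma> \<eta>. g \<xi> = f \<xi>" by simp
  have F: "\<eta> \<in> Field \<gamma>" using \<eta>(1) by (auto simp: under_def intro: FieldI1)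
  then have "m \<eta> g = m \<eta> f" using ad agree by (simp add: adaptive_def)
  moreover have "indexed_partition (Field \<nu>) X (m \<eta> f)"
    using ad F by (simp add: adaptive_def)
  then have "inf (m \<eta> f (f \<eta>)) (m \<eta> f (g \<eta>)) = bot"
    using f g \<eta> by (simp add: indexed_partition_def)
  ultimately show ?thesis using that \<eta> by simp
qed

text \<open>The set is large, but it is the downward closure of the meets of the branches up to \<open>\<alpha>\<close> that end
  in \<open>i\<close>. The set of those branches has size at most \<open>\<nu>\<close> to the power of \<open>|under \<gamma> \<alpha>|\<close>, a cardinal
  below \<open>\<gamma>\<close>.\<close>

lemma branch_bounds_lub:
  fixes X :: "'a::boolean_algebra" and \<gamma> :: "'g rel" and \<nu> :: "'n rel"
  assumes \<gamma>: "Cinfinite \<gamma>" and \<nu>: "ctwo \<le>o \<nu>"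
    and compl: "lt_complete (cardSuc (cexp_lt \<nu> \<gamma>)) TYPE('a)"
    and ad: "adaptive \<gamma> \<nu> X m" and \<alpha>: "\<alpha> \<in> Field \<gamma>"
  shows "\<exists>s. (\<forall>a\<in>branch_bounds \<gamma> \<nu> m \<alpha> i. a \<le> s) \<and>
    (\<forall>u. (\<forall>a\<in>branch_bounds \<gamma> \<nu> m \<alpha> i. a \<le> u) \<longrightarrow> s \<le> u)"
proof -
  let ?A = "under \<gamma> \<alpha>" and ?\<kappa> = "cexp_lt \<nu> \<gamma>"
  let ?F = "Func ?A (Field \<nu>)"
  have wo: "Well_order \<gamma>" using \<gamma> card_order_on_well_order_on by blast
  note sup = is_card_sup_cexp_lt[of \<nu> \<gamma>, unfolded is_card_sup_def]
  \<comment> \<open>A later round \<open>b\<close> exists since infinite cardinals are limits; it makes \<open>under \<gamma> \<alpha>\<close> small.\<close>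
  obtain b where b: "b \<in> Field \<gamma>" "\<alpha> \<noteq> b" "(\<alpha>, b) \<in> \<gamma>"
    using infinite_Card_order_limit[of \<gamma> \<alpha>] \<gamma> \<alpha> unfolding cinfinite_def by blast
  have "?A \<subseteq> underS \<gamma> b"
    using underS_under_trans[OF wo, of \<alpha> b] b(2,3) by (auto simp: underS_def)
  then have "|?A| \<le>o |underS \<gamma> b|" by (rule card_of_mono1)
  moreover have "|underS \<gamma> b| <o \<gamma>" by (rule card_of_underS[OF conjunct2[OF \<gamma>] b(1)])
  ultimately have A: "|?A| <o \<gamma>" by (rule ordLeq_ordLess_trans)
  have pow: "\<nu> ^c |?A| = |?F|" by (simp add: cexp_def Field_card_of)
  have F: "|?F| \<le>o ?\<kappa>"
    unfolding pow[symmetric]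
    by (rule bspec[OF conjunct1[OF conjunct2[OF sup]]]) (use A card_of_Card_order[of ?A] in blast)
  \<comment> \<open>Each single branch is short enough for its meet to exist, by Cantor's theorem.\<close>
  have A\<kappa>: "|?A| \<le>o ?\<kappa>"
    using ordLeq_cexp2[OF \<nu> card_of_Card_order[of ?A]] F unfolding pow
    by (rule ordLeq_transitive)
  have small: "|h ` B| <o cardSuc ?\<kappa>" if "|B| \<le>o ?\<kappa>" for h :: "'b \<Rightarrow> 'a" and B
    using ordLeq_transitive[OF card_of_image[of h B] that] sup
    by (simp add: cardSuc_ordLeq_ordLess card_of_Card_order)
  have "\<exists>q. (\<forall>a\<in>(\<lambda>\<beta>. m \<beta> f (f \<beta>)) ` ?A. q \<le> a) \<and>
      (\<forall>l. (\<forall>a\<in>(\<lambda>\<beta>. m \<beta> f (f \<beta>)) ` ?A. l \<le> a) \<longrightarrow> l \<le> q)" for f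
    by (rule lt_complete_glb[OF compl small[OF A\<kappa>]])
  then obtain q where q: "\<And>f. (\<forall>a\<in>(\<lambda>\<beta>. m \<beta> f (f \<beta>)) ` ?A. q f \<le> a) \<and>
      (\<forall>l. (\<forall>a\<in>(\<lambda>\<beta>. m \<beta> f (f \<beta>)) ` ?A. l \<le> a) \<longrightarrow> l \<le> q f)"
    by metis
  define G where "G = {f \<in> ?F. f \<alpha> = i}"
  have "|G| \<le>o |?F|" unfolding G_def by (rule card_of_mono1) blast
  then have "|G| \<le>o ?\<kappa>" using F by (rule ordLeq_transitive)
  then have "|q ` G| <o cardSuc ?\<kappa>" by (rule small)
  from lt_complete_lub[OF compl this]
  obtain s where s: "\<forall>a\<in>q ` G. a \<le> s" "\<forall>u. (\<forall>a\<in>q ` G. a \<le> u) \<longrightarrow> s \<le> u"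
    by (elim exE conjE)
  have \<alpha>A: "\<alpha> \<in> ?A" by (rule under_self[OF wo \<alpha>])
  have q_mem: "q f \<in> branch_bounds \<gamma> \<nu> m \<alpha> i" if "f \<in> G" for f
  proof -
    have "f \<alpha> = i" "\<forall>\<beta>\<in>?A. f \<beta> \<in> Field \<nu>" using that by (auto simp: G_def Func_def)
    moreover have "\<forall>\<beta>\<in>?A. q f \<le> m \<beta> f (f \<beta>)" using q[of f] by simp
    ultimately show ?thesis unfolding branch_bounds_def by (intro CollectI exI[of _ f]) simp
  qed
  have q_above: "\<exists>f\<in>G. Z \<le> q f" if Z: "Z \<in> branch_bounds \<gamma> \<nu> m \<alpha> i" for Z
  proof -
    obtain f where f: "f \<alpha> = i" "\<forall>\<beta>\<in>?A. f \<beta> \<in> Field \<nu> \<and> Z \<le> m \<beta> f (f \<beta>)"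
      using Z unfolding branch_bounds_def by blast
    \<comment> \<open>Only values up to \<open>\<alpha>\<close> matter, so \<open>f\<close> may be replaced by a member of the small index set.\<close>
    define g where "g \<beta> = (if \<beta> \<in> ?A then f \<beta> else undefined)" for \<beta>
    have "m \<beta> g = m \<beta> f" if "\<beta> \<in> ?A" for \<beta>
    proof -
      have "\<forall>\<eta>\<in>underS \<gamma> \<beta>. g \<eta> = f \<eta>"
        using under_underS_trans[OF wo that] underS_subset_under[of \<gamma> \<alpha>]
        by (auto simp: g_def)
      moreover have "\<beta> \<in> Field \<gamma>" using that by (auto simp: under_def intro: FieldI1)
      ultimately show ?thesis using ad by (simp add: adaptive_def)
    qed
    then have "\<forall>a\<in>(\<lambda>\<beta>. m \<beta> g (g \<beta>)) ` ?A. Z \<le> a" using f(2) by (auto simp: g_def)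
    then have "Z \<le> q g" using q[of g] by blast
    moreover have "g \<in> G" using f \<alpha>A by (auto simp: g_def Func_def G_def)
    ultimately show ?thesis by blast
  qed
  have "\<forall>a\<in>branch_bounds \<gamma> \<nu> m \<alpha> i. a \<le> s"
    using q_above s(1) by (meson image_eqI order_trans)
  moreover have "s \<le> u" if "\<forall>a\<in>branch_bounds \<gamma> \<nu> m \<alpha> i. a \<le> u" for u
    using that q_mem s(2) by blast
  ultimately show ?thesis by blast
qed

text \<open>If \<open>Z\<close> decides each value of the generic branch up to \<open>\<alpha>\<close> to be that of \<open>f\<close>, then \<open>Z\<close> lies below
  the pieces along \<open>f\<close>. Indeed, \<open>Z\<close> lies below the join of all branches that end in \<open>f \<alpha>\<close>; by
  induction it is disjoint from those that left \<open>f\<close> earlier, so only the part below \<open>m \<alpha> f (f \<alpha>)\<close>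
  remains.\<close>

lemma decided_branch:
  fixes X :: "'a::boolean_algebra" and \<gamma> :: "'g rel"
  assumes wo: "Well_order \<gamma>" and ad: "adaptive \<gamma> \<nu> X m"
    and lub: "\<forall>\<alpha>\<in>Field \<gamma>. \<forall>i u. (\<forall>a\<in>branch_bounds \<gamma> \<nu> m \<alpha> i. a \<le> u) \<longrightarrow> U \<alpha> i \<le> u"
    and f: "\<And>\<beta>. \<beta> \<in> under \<gamma> \<alpha> \<Longrightarrow> f \<beta> \<in> Field \<nu> \<and> Z \<le> U \<beta> (f \<beta>)"
    and \<alpha>: "\<alpha> \<in> Field \<gamma>"
  shows "Z \<le> m \<alpha> f (f \<alpha>)"
  using \<alpha> f
proof (induction \<alpha> rule: wf_induct_rule[OF wf_strict[OF wo]])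
  case (1 \<alpha>)
  have below: "Z \<le> m \<eta> f (f \<eta>)" if \<eta>: "\<eta> \<in> underS \<gamma> \<alpha>" for \<eta>
  proof (rule "1.IH")
    show "(\<eta>, \<alpha>) \<in> \<gamma> - Id" "\<eta> \<in> Field \<gamma>" using \<eta> by (auto simp: underS_def intro: FieldI1)
    fix \<beta> assume "\<beta> \<in> under \<gamma> \<eta>"
    then have "\<beta> \<in> under \<gamma> \<alpha>"
      using underS_under_trans[OF wo \<eta>] underS_subset_under[of \<gamma> \<alpha>] by blast
    then show "f \<beta> \<in> Field \<nu> \<and> Z \<le> U \<beta> (f \<beta>)" by (rule "1.prems"(2))
  qed
  have \<alpha>A: "\<alpha> \<in> under \<gamma> \<alpha>" by (rule under_self[OF wo "1.prems"(1)])
  have "inf Z (U \<alpha> (f \<alpha>)) \<le> m \<alpha> f (f \<alpha>)"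
  proof (rule inf_lub_le[of "branch_bounds \<gamma> \<nu> m \<alpha> (f \<alpha>)"])
    show "\<forall>u. (\<forall>a\<in>branch_bounds \<gamma> \<nu> m \<alpha> (f \<alpha>). a \<le> u) \<longrightarrow> U \<alpha> (f \<alpha>) \<le> u"
      using lub "1.prems"(1) by blast
    fix a assume "a \<in> branch_bounds \<gamma> \<nu> m \<alpha> (f \<alpha>)"
    then obtain g where g: "g \<alpha> = f \<alpha>" "\<forall>\<beta>\<in>under \<gamma> \<alpha>. g \<beta> \<in> Field \<nu> \<and> a \<le> m \<beta> g (g \<beta>)"
      unfolding branch_bounds_def by blast
    show "inf Z a \<le> m \<alpha> f (f \<alpha>)"
    proof (cases "\<forall>\<beta>\<in>under \<gamma> \<alpha>. f \<beta> = g \<beta>")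
      case True
      then have "\<forall>\<beta>\<in>underS \<gamma> \<alpha>. g \<beta> = f \<beta>" using underS_subset_under[of \<gamma> \<alpha>] by fastforce
      then have "m \<alpha> g = m \<alpha> f" using ad "1.prems"(1) by (simp add: adaptive_def)
      then have "a \<le> m \<alpha> f (f \<alpha>)" using g \<alpha>A by force
      then show ?thesis by (rule le_infI2)
    next
      case False
      then obtain \<beta> where "\<beta> \<in> under \<gamma> \<alpha>" "f \<beta> \<noteq> g \<beta>" by blast
      then obtain \<eta> where \<eta>: "\<eta> \<in> under \<gamma> \<alpha>" "f \<eta> \<noteq> g \<eta>"
        "inf (m \<eta> f (f \<eta>)) (m \<eta> g (g \<eta>)) = bot"
        using adaptive_first_difference[OF wo ad "1.prems"(1), of f g] "1.prems"(2) g(2) by metis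
      then have "\<eta> \<in> underS \<gamma> \<alpha>" using g(1) by (auto simp: under_def underS_def)
      then have "inf Z a \<le> inf (m \<eta> f (f \<eta>)) (m \<eta> g (g \<eta>))"
        using below g(2) \<eta>(1) by (meson inf_mono)
      then show ?thesis using \<eta>(3) by (metis bot_least order_trans)
    qed
  qed
  then show ?case using "1.prems"(2)[OF \<alpha>A] by (simp add: inf_absorb1)
qed

text \<open>Distributivity extends from sequences to trees of partitions.\<close>

lemma distributive_adaptive:
  fixes X :: "'a::boolean_algebra" and \<gamma> :: "'g rel" and \<nu> :: "'n rel"
  assumes \<gamma>: "Cinfinite \<gamma>" and \<nu>: "Cinfinite \<nu>"
    and compl: "lt_complete (cardSuc (cexp_lt \<nu> \<gamma>)) TYPE('a)"
    and dist: "distributive_alg \<gamma> \<nu> TYPE('a)"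
    and ad: "adaptive \<gamma> \<nu> X m" and X: "X \<noteq> bot"
  shows "\<exists>f Z. Z \<noteq> bot \<and> (\<forall>\<alpha>\<in>Field \<gamma>. Z \<le> m \<alpha> f (f \<alpha>))"
proof -
  have wo: "Well_order \<gamma>" using \<gamma> card_order_on_well_order_on by blast
  have ne: "Field \<gamma> \<noteq> {}" using \<gamma> unfolding cinfinite_def by auto
  have "\<forall>\<alpha>\<in>Field \<gamma>. \<forall>i. \<exists>s. (\<forall>a\<in>branch_bounds \<gamma> \<nu> m \<alpha> i. a \<le> s) \<and>
    (\<forall>u. (\<forall>a\<in>branch_bounds \<gamma> \<nu> m \<alpha> i. a \<le> u) \<longrightarrow> s \<le> u)"
    using branch_bounds_lub[OF \<gamma> ctwo_ordLeq_Cinfinite[OF \<nu>] compl ad] by blast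
  then obtain U where
    ub: "\<And>\<alpha> i a. \<alpha> \<in> Field \<gamma> \<Longrightarrow> a \<in> branch_bounds \<gamma> \<nu> m \<alpha> i \<Longrightarrow> a \<le> U \<alpha> i" and
    lub: "\<forall>\<alpha>\<in>Field \<gamma>. \<forall>i u. (\<forall>a\<in>branch_bounds \<gamma> \<nu> m \<alpha> i. a \<le> u) \<longrightarrow> U \<alpha> i \<le> u"
    by metis
  obtain i0 where i0: "i0 \<in> Field \<nu>"
    using \<nu> unfolding cinfinite_def by (metis equals0I finite.emptyI)
  have disj: "inf (U \<alpha> i) (U \<alpha> j) = bot"
    if \<alpha>: "\<alpha> \<in> Field \<gamma>" and ij: "i \<noteq> j" for \<alpha> i j
  proof -
    have \<alpha>A: "\<alpha> \<in> under \<gamma> \<alpha>" by (rule under_self[OF wo \<alpha>])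
    have "inf a b \<le> bot"
      if a: "a \<in> branch_bounds \<gamma> \<nu> m \<alpha> i" and b: "b \<in> branch_bounds \<gamma> \<nu> m \<alpha> j" for a b
    proof -
      obtain f where f: "f \<alpha> = i" "\<forall>\<beta>\<in>under \<gamma> \<alpha>. f \<beta> \<in> Field \<nu> \<and> a \<le> m \<beta> f (f \<beta>)"
        using a unfolding branch_bounds_def by blast
      obtain g where g: "g \<alpha> = j" "\<forall>\<beta>\<in>under \<gamma> \<alpha>. g \<beta> \<in> Field \<nu> \<and> b \<le> m \<beta> g (g \<beta>)"
        using b unfolding branch_bounds_def by blast
      obtain \<eta> where "\<eta> \<in> under \<gamma> \<alpha>" "inf (m \<eta> f (f \<eta>)) (m \<eta> g (g \<eta>)) = bot"
        using adaptive_first_difference[OF wo ad \<alpha>, of f g \<alpha>] f g ij \<alpha>A by metis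
      then show ?thesis using f(2) g(2) by (metis inf_mono)
    qed
    then have "inf a (U \<alpha> j) \<le> bot" if "a \<in> branch_bounds \<gamma> \<nu> m \<alpha> i" for a
      using inf_lub_le[of "branch_bounds \<gamma> \<nu> m \<alpha> j" "U \<alpha> j" a bot] bspec[OF lub \<alpha>] that by blast
    then have "inf (U \<alpha> j) (U \<alpha> i) \<le> bot"
      using inf_lub_le[of "branch_bounds \<gamma> \<nu> m \<alpha> i" "U \<alpha> i" "U \<alpha> j" bot] bspec[OF lub \<alpha>]
      by (metis inf.commute)
    then show ?thesis by (simp add: inf.commute le_bot)
  qed
  have part: "indexed_partition (Field \<nu>) X (U \<alpha>)" if "\<alpha> \<in> Field \<gamma>" for \<alpha>
    using that
  proof (induction \<alpha> rule: wf_induct_rule[OF wf_strict[OF wo]])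
    case (1 \<alpha>)
    have "\<exists>i\<in>Field \<nu>. inf Y (U \<alpha> i) \<noteq> bot" if Y: "Y \<noteq> bot" "Y \<le> X" for Y
    proof -
      \<comment> \<open>Distributivity speaks about sequences of length \<open>\<gamma>\<close>: from round \<open>\<alpha>\<close> on, pad with the
        trivial partition, whose only nonzero piece has index \<open>i0\<close>.\<close>
      define P where "P \<beta> = (if \<beta> \<in> underS \<gamma> \<alpha> then U \<beta>
        else (\<lambda>i. if i = i0 then top else bot))" for \<beta>
      have "indexed_partition (Field \<nu>) Y (P \<beta>)" if \<beta>: "\<beta> \<in> Field \<gamma>" for \<beta>
      proof (cases "\<beta> \<in> underS \<gamma> \<alpha>")
        case True
        then have "indexed_partition (Field \<nu>) X (U \<beta>)"
          using "1.IH" \<beta> by (auto simp: underS_def)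
        then show ?thesis
          using Y True unfolding indexed_partition_def P_def by auto
      next
        case False
        then show ?thesis
          using i0 unfolding indexed_partition_def P_def by auto
      qed
      then have "\<forall>\<beta>\<in>Field \<gamma>. indexed_partition (Field \<nu>) Y (P \<beta>)" by blast
      then obtain f Z where Z: "Z \<noteq> bot" "Z \<le> Y"
        and f: "\<forall>\<beta>\<in>Field \<gamma>. f \<beta> \<in> Field \<nu> \<and> Z \<le> P \<beta> (f \<beta>)"
        using distributive_alg_indexed[OF dist conjunct2[OF \<nu>] Y(1) _ ne] by metis
      have FS: "\<beta> \<in> Field \<gamma>" if "\<beta> \<in> underS \<gamma> \<alpha>" for \<beta>
        using that by (auto simp: underS_def intro: FieldI1)
      have below: "Z \<le> m \<beta> f (f \<beta>)" if \<beta>: "\<beta> \<in> underS \<gamma> \<alpha>" for \<beta>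
      proof (rule decided_branch[OF wo ad lub])
        show "\<beta> \<in> Field \<gamma>" by (rule FS[OF \<beta>])
        fix \<eta> assume "\<eta> \<in> under \<gamma> \<beta>"
        then have "\<eta> \<in> underS \<gamma> \<alpha>"
          by (rule underS_under_trans[OF wo \<beta>])
        then show "f \<eta> \<in> Field \<nu> \<and> Z \<le> U \<eta> (f \<eta>)"
          using f FS unfolding P_def by fastforce
      qed
      obtain i where i: "i \<in> Field \<nu>" "inf Z (m \<alpha> f i) \<noteq> bot"
        using ad "1.prems" Z Y(2) order_trans
        unfolding adaptive_def indexed_partition_def by metis
      \<comment> \<open>The branch that \<open>Z\<close> decided below \<open>\<alpha>\<close>, prolonged by the index of a piece that \<open>Z\<close> meets.\<close>
      define g where "g = f(\<alpha> := i)"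
      have gm: "m \<beta> g = m \<beta> f" if "\<beta> \<in> under \<gamma> \<alpha>" for \<beta>
      proof -
        have "\<forall>\<eta>\<in>underS \<gamma> \<beta>. g \<eta> = f \<eta>"
          using under_underS_trans[OF wo that] unfolding g_def by (auto simp: underS_def)
        moreover have "\<beta> \<in> Field \<gamma>" using that by (auto simp: under_def intro: FieldI1)
        ultimately show ?thesis using ad by (simp add: adaptive_def)
      qed
      have "g \<beta> \<in> Field \<nu> \<and> inf Z (m \<alpha> f i) \<le> m \<beta> g (g \<beta>)" if \<beta>: "\<beta> \<in> under \<gamma> \<alpha>" for \<beta>
      proof (cases "\<beta> = \<alpha>")
        case True
        then show ?thesis using i(1) gm[OF \<beta>] by (simp add: g_def)
      next
        case False
        then have "\<beta> \<in> underS \<gamma> \<alpha>" using \<beta> by (auto simp: under_def underS_def)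
        then show ?thesis
          using False f FS below gm[OF \<beta>] by (simp add: g_def le_infI1)
      qed
      then have "inf Z (m \<alpha> f i) \<in> branch_bounds \<gamma> \<nu> m \<alpha> i"
        unfolding branch_bounds_def by (intro CollectI exI[of _ g]) (simp add: g_def)
      then have "inf Z (m \<alpha> f i) \<le> U \<alpha> i" by (rule ub[OF "1.prems"])
      then have "inf Z (m \<alpha> f i) \<le> inf Y (U \<alpha> i)"
        using Z(2) by (simp add: le_infI1)
      then show ?thesis using i by (metis le_bot)
    qed
    then show ?case
      using disj[OF "1.prems"] unfolding indexed_partition_def by blast
  qed
  obtain f Z where Z: "Z \<noteq> bot" and f: "\<forall>\<alpha>\<in>Field \<gamma>. f \<alpha> \<in> Field \<nu> \<and> Z \<le> U \<alpha> (f \<alpha>)"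
    using distributive_alg_indexed[OF dist conjunct2[OF \<nu>] X _ ne] part by metis
  have "Z \<le> m \<alpha> f (f \<alpha>)" if \<alpha>: "\<alpha> \<in> Field \<gamma>" for \<alpha>
  proof (rule decided_branch[OF wo ad lub _ \<alpha>])
    fix \<beta> assume "\<beta> \<in> under \<gamma> \<alpha>"
    then have "\<beta> \<in> Field \<gamma>" by (auto simp: under_def intro: FieldI1)
    then show "f \<beta> \<in> Field \<nu> \<and> Z \<le> U \<beta> (f \<beta>)" using f by blast
  qed
  then show ?thesis using Z by blast
qed

section \<open>Strategies as adaptive partitions\<close>

text \<open>Cut's strategy becomes an adaptive partition once Choose's responses are coded by indices; a
  nonzero lower bound of one branch is a win for Choose.\<close>

lemma distributive_no_winning_strategy:
  fixes X :: "'a::boolean_algebra" and \<gamma> :: "'g rel" and \<nu> :: "'n rel"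
  assumes \<gamma>: "Cinfinite \<gamma>" and \<nu>: "Cinfinite \<nu>"
    and compl: "lt_complete (cardSuc (cexp_lt \<nu> \<gamma>)) TYPE('a)"
    and dist: "distributive_alg \<gamma> \<nu> TYPE('a)" and X: "X \<noteq> bot"
  shows "\<not> cut_winning_strategy \<nu> X \<gamma> \<sigma>"
proof
  assume win: "cut_winning_strategy \<nu> X \<gamma> \<sigma>"
  have wo: "Well_order \<gamma>" using \<gamma> card_order_on_well_order_on by blast
  \<comment> \<open>An index of a \<open>bot\<close> piece codes no legal response, and after it \<open>\<sigma>\<close> may give anything. Replacing
    illegal moves by \<open>{X}\<close> makes every sequence of indices code a run of partitions of \<open>X\<close>. The branch
    found in the end avoids \<open>bot\<close> and is therefore a legal play, on which \<open>\<tau>\<close> agrees with \<open>\<sigma>\<close>.\<close>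
  define \<tau> where "\<tau> \<alpha> p = (if cut_move \<nu> X (\<sigma> \<alpha> p) then \<sigma> \<alpha> p else {X})" for \<alpha> p
  have \<tau>: "cut_move \<nu> X (\<tau> \<alpha> p)" for \<alpha> p
    using cut_move_singleton[OF \<nu> X] by (simp add: \<tau>_def)
  have "\<forall>W. \<exists>P. cut_move \<nu> X W \<longrightarrow>
      indexed_partition (Field \<nu>) X P \<and> (\<forall>i. P i \<noteq> bot \<longrightarrow> P i \<in> W)"
    using cut_move_indexed[OF conjunct2[OF \<nu>]] by blast
  from choice[OF this] obtain d where "\<forall>W. cut_move \<nu> X W \<longrightarrow>
      indexed_partition (Field \<nu>) X (d W) \<and> (\<forall>i. d W i \<noteq> bot \<longrightarrow> d W i \<in> W)" ..
  then have d: "\<And>W. cut_move \<nu> X W \<Longrightarrow> indexed_partition (Field \<nu>) X (d W)"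
    and dW: "\<And>W i. cut_move \<nu> X W \<Longrightarrow> d W i \<noteq> bot \<Longrightarrow> d W i \<in> W"
    by simp_all
  define play where "play f = wfrec (\<gamma> - Id)
    (\<lambda>p \<alpha>. let W = \<tau> \<alpha> (restrict p (underS \<gamma> \<alpha>)) in (W, d W (f \<alpha>)))" for f
  define move where "move \<alpha> f = \<tau> \<alpha> (restrict (play f) (underS \<gamma> \<alpha>))" for \<alpha> f
  have play: "play f \<alpha> = (move \<alpha> f, d (move \<alpha> f) (f \<alpha>))" for f \<alpha>
  proof -
    have "restrict (cut h (\<gamma> - Id) \<alpha>) (underS \<gamma> \<alpha>) = restrict h (underS \<gamma> \<alpha>)"
      for h :: "'g \<Rightarrow> 'a set \<times> 'a"
      by (auto simp: restrict_def cut_def underS_def)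
    then show ?thesis
      unfolding move_def unfolding play_def
      by (subst wfrec[OF wf_strict[OF wo]]) (simp add: Let_def)
  qed
  have cong: "move \<alpha> f = move \<alpha> g" if "\<forall>\<beta>\<in>underS \<gamma> \<alpha>. f \<beta> = g \<beta>" for \<alpha> f g
    using that
  proof (induction \<alpha> rule: wf_induct_rule[OF wf_strict[OF wo]])
    case (1 \<alpha>)
    have "play f \<beta> = play g \<beta>" if \<beta>: "\<beta> \<in> underS \<gamma> \<alpha>" for \<beta>
    proof -
      have "\<beta> \<in> under \<gamma> \<alpha>" using \<beta> underS_subset_under[of \<gamma> \<alpha>] by blast
      then have "move \<beta> f = move \<beta> g"
        using "1.IH"[of \<beta>] "1.prems" \<beta> under_underS_trans[OF wo] by (auto simp: underS_def)
      then show ?thesis using "1.prems" \<beta> by (simp add: play)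
    qed
    then have "restrict (play f) (underS \<gamma> \<alpha>) = restrict (play g) (underS \<gamma> \<alpha>)" by auto
    then show ?case unfolding move_def by simp
  qed
  have mv: "cut_move \<nu> X (move \<alpha> f)" for \<alpha> f by (simp add: move_def \<tau>)
  have "adaptive \<gamma> \<nu> X (\<lambda>\<alpha> f. d (move \<alpha> f))"
    unfolding adaptive_def using d[OF mv] cong by metis
  then obtain f Z where Z: "Z \<noteq> bot" "\<forall>\<alpha>\<in>Field \<gamma>. Z \<le> d (move \<alpha> f) (f \<alpha>)"
    using distributive_adaptive[OF \<gamma> \<nu> compl dist _ X] by metis
  have legal: "legal_play \<nu> X (Field \<gamma>) (play f)"
    unfolding legal_play_def
  proof (intro ballI conjI)
    fix \<alpha> assume "\<alpha> \<in> Field \<gamma>"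
    then have "d (move \<alpha> f) (f \<alpha>) \<noteq> bot" using Z by (metis le_bot)
    then show "snd (play f \<alpha>) \<in> fst (play f \<alpha>)" using dW[OF mv] by (simp add: play)
  qed (simp add: play mv)
  have "legal_play \<nu> X (underS \<gamma> \<alpha>) (play f)" for \<alpha>
    using legal unfolding legal_play_def by (auto simp: underS_def intro: FieldI1)
  then have "cut_move \<nu> X (\<sigma> \<alpha> (restrict (play f) (underS \<gamma> \<alpha>)))" if "\<alpha> \<in> Field \<gamma>" for \<alpha>
    using win that unfolding cut_winning_strategy_def cut_strategy_def by blast
  then have "follows \<gamma> \<sigma> (play f)"
    unfolding follows_def by (simp add: play move_def \<tau>_def)
  moreover have "choose_wins \<gamma> (play f)"
    unfolding choose_wins_def has_nonzero_lower_bound_def using Z by (auto simp: play)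
  ultimately show False using win legal unfolding cut_winning_strategy_def by blast
qed

lemma no_winning_strategy_distributive:
  fixes \<gamma> :: "'g rel" and \<nu> :: "'n rel"
  assumes "\<And>(X :: 'a::boolean_algebra) \<sigma>. X \<noteq> bot \<Longrightarrow> \<not> cut_winning_strategy \<nu> X \<gamma> \<sigma>"
  shows "distributive_alg \<gamma> \<nu> TYPE('a)"
  unfolding distributive_alg_def
proof (intro allI impI)
  fix X :: 'a and W :: "'g \<Rightarrow> 'a set"
  assume W: "X \<noteq> bot \<and> (\<forall>\<alpha>\<in>Field \<gamma>. max_antichain_below X (W \<alpha>) \<and> |W \<alpha>| \<le>o \<nu>)"
  then have "cut_strategy \<nu> X \<gamma> (\<lambda>\<alpha> _. W \<alpha>)"
    by (simp add: cut_strategy_def cut_move_def)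
  then obtain p where p: "legal_play \<nu> X (Field \<gamma>) p" "follows \<gamma> (\<lambda>\<alpha> _. W \<alpha>) p"
    "choose_wins \<gamma> p"
    using assms[of X "\<lambda>\<alpha> _. W \<alpha>"] W unfolding cut_winning_strategy_def by blast
  then have "\<forall>\<alpha>\<in>Field \<gamma>. snd (p \<alpha>) \<in> W \<alpha>"
    by (auto simp: legal_play_def follows_def)
  then show "\<exists>x. (\<forall>\<alpha>\<in>Field \<gamma>. x \<alpha> \<in> W \<alpha>) \<and> has_nonzero_lower_bound (x ` Field \<gamma>)"
    using p(3) unfolding choose_wins_def by (intro exI[of _ "\<lambda>\<alpha>. snd (p \<alpha>)"]) blast
qed

theorem mainTheorem7:
  fixes \<gamma> :: "'g rel" and \<nu> :: "'n rel"
  assumes "Cinfinite \<gamma>"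
    and "Cinfinite \<nu>" and "regularCard \<nu>"
    and "lt_complete (cardSuc (cexp_lt \<nu> \<gamma>)) TYPE('a::boolean_algebra)"
  shows "distributive_alg \<gamma> \<nu> TYPE('a) \<longleftrightarrow>
    (\<forall>X :: 'a. X \<noteq> bot \<longrightarrow> \<not> (\<exists>\<sigma>. cut_winning_strategy \<nu> X \<gamma> \<sigma>))"
  using distributive_no_winning_strategy[OF assms(1,2,4)]
    no_winning_strategy_distributive[of \<nu> \<gamma>] by blast

end
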